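(* For every topological model $\mathcal{M}=((X,\tau),\nu)$ and every formula $\varphi$: $$\llbracket\Diamond_d\varphi\rrbracket^{\mathcal{M}}=d(\llbracket\varphi\rrbracket^{\mathcal{M}}),$$ where $d(A)=\{x\in X: x\text{ is a limit point of }A\}$ is the Cantor derivative operator.
   Context: Nonstandard setting. For a topological space $(X,\tau)$ let $S=X\cup\mathbb{R}$ and let $V(S)=\bigcup_{k\in\mathbb{N}_0}V_k(S)$ be the superstructure over $S$, where $V_0(S)=S$ and $V_{k+1}(S)=V_k(S)\cup\mathcal{P}(V_k(S))$. A polysaturated nonstandard model is a superstructure $V({}^*S)$ with a star map $A\mapsto{}^*A$ from $V(S)$ to $V({}^*S)$ such that: (1) Extension: ${}^*s=s$ for all $s\in S$; (2) Transfer: a bounded quantifier formula $\Phi(A_1,\dots,A_n)$ is true in $V(S)$ iff $\Phi({}^*A_1,\dots,{}^*A_n)$ is true in $V({}^*S)$; (3) Saturation: every family of internal sets of cardinality at most $\kappa$ with the finite intersection property has non-empty intersection, where $\kappa\ge|V(S)|$ is a fixed cardinal. A set is internal if it is an element of ${}^*C$ for some $C\in V(S)$. One such model is fixed throughout. In particular $X\subseteq{}^*X$. Halo. For $x\in X$, $\mathcal{N}(x)=\{U\in\tau: x\in U\}$ and $\mu(x)=\bigcap_{U\in\mathcal{N}(x)}{}^*U$. Modal semantics. Formulas are built from propositional variables, $\bot$, $\neg$, $\wedge$ and a unary $\Diamond_d$. A topological model is $\mathcal{M}=((X,\tau),\nu)$ with $(X,\tau)$ a topological space and $\nu$ a map from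 propositional variables to $\mathcal{P}(X)$. The extension $\llbracket\varphi\rrbracket^{\mathcal{M}}\subseteq X$ is defined with $\llbracket p\rrbracket=\nu(p)$, Boolean clauses as usual, and $\llbracket\Diamond_d\varphi\rrbracket=\{x\in X:\mu(x)\cap({}^*\llbracket\varphi\rrbracket\setminus\{x\})\neq\emptyset\}$. A point $x$ is a limit point of $A$ if every open $U$ containing $x$ meets $A\setminus\{x\}$. *)

theory Defs
  imports "HOL-Analysis.Abstract_Topology"
begin

unbundle cardinal_syntax

section \<open>Superstructures\<close>

text \<open>
  The levels of a superstructure grow beyond any bound given by a single application of the
  powerset, so they cannot be spelled out as HOL types. Individuals and sets over them are
  instead all taken from one type \<open>'u\<close>, and a map \<open>c :: 'u set \<Rightarrow> 'u\<close> turns a collection of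
  objects into the object that is its set. Only the values of \<open>c\<close> on collections bounded by some
  level matter; \<open>c\<close> cannot be injective on all collections.
\<close>

primrec level :: "('u set \<Rightarrow> 'u) \<Rightarrow> 'u set \<Rightarrow> nat \<Rightarrow> 'u set" where
  "level c S 0 = S"
| "level c S (Suc k) = level c S k \<union> c ` Pow (level c S k)"

definition superstructure :: "('u set \<Rightarrow> 'u) \<Rightarrow> 'u set \<Rightarrow> 'u set" where
  "superstructure c S = (\<Union>k. level c S k)"

text \<open>
  \<open>c\<close> represents sets correctly over \<open>S\<close>: extensionality holds, and the elements of \<open>S\<close> are
  individuals (none of them is a set).
\<close>

definition codes_superstructure :: "('u set \<Rightarrow> 'u) \<Rightarrow> 'u set \<Rightarrow> bool" where
  "codes_superstructure c S \<longleftrightarrow>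
     inj_on c (\<Union>k. Pow (level c S k)) \<and> S \<inter> c ` (\<Union>k. Pow (level c S k)) = {}"

text \<open>The elements of an object of the superstructure; individuals have none.\<close>

definition elts :: "('u set \<Rightarrow> 'u) \<Rightarrow> 'u set \<Rightarrow> 'u \<Rightarrow> 'u set" where
  "elts c S b = {a. \<exists>k. \<exists>A \<subseteq> level c S k. b = c A \<and> a \<in> A}"

section \<open>Bounded quantifier formulas\<close>

text \<open>
  \<open>BAll x y \<Phi>\<close> stands for \<open>\<forall>x\<in>y. \<Phi>\<close>, where the bound \<open>y\<close> is evaluated outside the scope of \<open>x\<close>.
  The other connectives and the bounded existential quantifier are definable. Parameters
  \<open>A\<^sub>1, \<dots>, A\<^sub>n\<close> are supplied as values of free variables.
\<close>

datatype bqf =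
    Eq nat nat
  | Mem nat nat
  | Not bqf
  | And bqf bqf
  | BAll nat nat bqf

primrec holds :: "('u \<Rightarrow> 'u set) \<Rightarrow> (nat \<Rightarrow> 'u) \<Rightarrow> bqf \<Rightarrow> bool" where
  "holds E \<rho> (Eq x y) \<longleftrightarrow> \<rho> x = \<rho> y"
| "holds E \<rho> (Mem x y) \<longleftrightarrow> \<rho> x \<in> E (\<rho> y)"
| "holds E \<rho> (Not \<Phi>) \<longleftrightarrow> \<not> holds E \<rho> \<Phi>"
| "holds E \<rho> (And \<Phi> \<Psi>) \<longleftrightarrow> holds E \<rho> \<Phi> \<and> holds E \<rho> \<Psi>"
| "holds E \<rho> (BAll x y \<Phi>) \<longleftrightarrow> (\<forall>a \<in> E (\<rho> y). holds E (\<rho>(x := a)) \<Phi>)"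

section \<open>Polysaturated nonstandard models\<close>

text \<open>
  In the following, \<open>S\<close> is the set of standard individuals, \<open>S'\<close> is the set \<open>\<^sup>*S\<close>, and
  \<open>star\<close> is the star map from \<open>V(S)\<close> to \<open>V(\<^sup>*S)\<close>.
\<close>

definition internal ::
    "('u set \<Rightarrow> 'u) \<Rightarrow> 'u set \<Rightarrow> 'u set \<Rightarrow> ('u \<Rightarrow> 'u) \<Rightarrow> 'u \<Rightarrow> bool" where
  "internal c S S' star B \<longleftrightarrow>
     B \<in> superstructure c S' - S' \<and> (\<exists>C \<in> superstructure c S. B \<in> elts c S' (star C))"

definition polysaturated_model ::
    "('u set \<Rightarrow> 'u) \<Rightarrow> 'u set \<Rightarrow> 'u set \<Rightarrow> ('u \<Rightarrow> 'u) \<Rightarrow> 'k rel \<Rightarrow> bool" where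
  "polysaturated_model c S S' star \<kappa> \<longleftrightarrow>
     codes_superstructure c S \<and>
     codes_superstructure c S' \<and>
     star ` superstructure c S \<subseteq> superstructure c S' \<and>
     star (c S) = c S' \<and>
     \<comment> \<open>Extension\<close>
     (\<forall>s \<in> S. star s = s) \<and>
     \<comment> \<open>Transfer\<close>
     (\<forall>\<Phi> \<rho>. range \<rho> \<subseteq> superstructure c S \<longrightarrow>
        (holds (elts c S) \<rho> \<Phi> \<longleftrightarrow> holds (elts c S') (star \<circ> \<rho>) \<Phi>)) \<and>
     \<comment> \<open>Saturation\<close>
     Card_order \<kappa> \<and> |superstructure c S| \<le>o \<kappa> \<and>
     (\<forall>F. (\<forall>B \<in> F. internal c S S' star B) \<and> |F| \<le>o \<kappa> \<and>
          (\<forall>G. finite G \<and> G \<subseteq> F \<longrightarrow> \<Inter> (elts c S' ` G) \<noteq> {}) \<longrightarrow>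
          \<Inter> (elts c S' ` F) \<noteq> {})"

text \<open>\<open>\<^sup>*A\<close> as a collection, for a collection \<open>A\<close> of standard individuals.\<close>

definition nsext :: "('u set \<Rightarrow> 'u) \<Rightarrow> 'u set \<Rightarrow> ('u \<Rightarrow> 'u) \<Rightarrow> 'u set \<Rightarrow> 'u set" where
  "nsext c S' star A = elts c S' (star (c A))"

definition halo ::
    "('u set \<Rightarrow> 'u) \<Rightarrow> 'u set \<Rightarrow> ('u \<Rightarrow> 'u) \<Rightarrow> 'u topology \<Rightarrow> 'u \<Rightarrow> 'u set" where
  "halo c S' star T x = (\<Inter>U \<in> {U. openin T U \<and> x \<in> U}. nsext c S' star U)"

section \<open>Modal formulas and their extensions\<close>

datatype 'p fm =
    Var 'p
  | Falsum
  | Neg "'p fm"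
  | Conj "'p fm" "'p fm"
  | Diamond_d "'p fm"

primrec extension ::
    "('u set \<Rightarrow> 'u) \<Rightarrow> 'u set \<Rightarrow> ('u \<Rightarrow> 'u) \<Rightarrow> 'u topology \<Rightarrow> ('p \<Rightarrow> 'u set) \<Rightarrow> 'p fm \<Rightarrow> 'u set" where
  "extension c S' star T \<nu> (Var p) = \<nu> p"
| "extension c S' star T \<nu> Falsum = {}"
| "extension c S' star T \<nu> (Neg \<phi>) = topspace T - extension c S' star T \<nu> \<phi>"
| "extension c S' star T \<nu> (Conj \<phi> \<psi>) = extension c S' star T \<nu> \<phi> \<inter> extension c S' star T \<nu> \<psi>"
| "extension c S' star T \<nu> (Diamond_d \<phi>) =
     {x \<in> topspace T. halo c S' star T x \<inter> (nsext c S' star (extension c S' star T \<nu> \<phi>) - {x}) \<noteq> {}}"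

end

theory Submission
  imports Defs
begin

text \<open>
  For open \<open>U \<ni> x\<close> write \<open>W U = (U \<inter> A) - {x}\<close>. Transfer makes the star map on sets of individuals
  commute with Boolean operations and fix singletons, so that \<open>\<^sup>*(W U) = (\<^sup>*U \<inter> \<^sup>*A) - {x}\<close>, and the
  halo condition on \<open>x\<close> says that the sets \<open>\<^sup>*(W U)\<close> have a common element. Such an element makes
  each \<open>\<^sup>*(W U)\<close>, hence each \<open>W U\<close>, nonempty, so that \<open>x\<close> is a limit point of \<open>A\<close>. Conversely, at a
  limit point of \<open>A\<close> the sets \<open>W U\<close> are nonempty, and as the neighbourhoods of \<open>x\<close> are closed under
  finite intersections, the \<open>\<^sup>*(W U)\<close> have the finite intersection property. They are internal and
  indexed by objects of the standard superstructure, so saturation yields a common element.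
\<close>

section \<open>Consequences of transfer for sets of individuals\<close>

lemma in_superstructure_level: "a \<in> level c S k \<Longrightarrow> a \<in> superstructure c S"
  by (auto simp: superstructure_def)

lemma code_in_superstructure: "A \<subseteq> level c S k \<Longrightarrow> c A \<in> superstructure c S"
  by (rule in_superstructure_level[of _ _ _ "Suc k"]) auto

lemma individual_in_superstructure: "s \<in> S \<Longrightarrow> s \<in> superstructure c S"
  by (rule in_superstructure_level[of _ _ _ 0]) simp

lemma elts_code:
  assumes "codes_superstructure c S" and "A \<subseteq> level c S k"
  shows "elts c S (c A) = A"
proof -
  have "B = A" if "c A = c B" "B \<subseteq> level c S j" for B j
    using assms that unfolding codes_superstructure_def inj_on_def by blast
  then show ?thesis
    using assms(2) unfolding elts_def by blast
qed

lemma code_not_individual: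
  assumes "codes_superstructure c S" and "A \<subseteq> level c S k"
  shows "c A \<notin> S"
  using assms unfolding codes_superstructure_def by blast

lemma transfer:
  assumes "polysaturated_model c S S' star \<kappa>" and "range \<rho> \<subseteq> superstructure c S"
  shows "holds (elts c S) \<rho> \<Phi> \<longleftrightarrow> holds (elts c S') (star \<circ> \<rho>) \<Phi>"
  using assms unfolding polysaturated_model_def by blast

lemma transfer_Mem:
  assumes M: "polysaturated_model c S S' star \<kappa>"
    and "a \<in> superstructure c S" and "b \<in> superstructure c S"
  shows "star a \<in> elts c S' (star b) \<longleftrightarrow> a \<in> elts c S b"
  using transfer[OF M, of "(\<lambda>_. a)(1 := b)" "Mem 0 1"] assms(2,3) by auto

context
  fixes c :: "'u set \<Rightarrow> 'u" and S S' :: "'u set" and star :: "'u \<Rightarrow> 'u" and \<kappa> :: "'k rel"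
  assumes M: "polysaturated_model c S S' star \<kappa>"
begin

lemma codes_standard: "codes_superstructure c S"
  and codes_nonstandard: "codes_superstructure c S'"
  using M unfolding polysaturated_model_def by blast+

lemma star_individual: "s \<in> S \<Longrightarrow> star s = s"
  using M unfolding polysaturated_model_def by blast

lemma elts_standard: "A \<subseteq> S \<Longrightarrow> elts c S (c A) = A"
  by (rule elts_code[OF codes_standard, of _ 0]) simp

lemma code_subset_in_superstructure: "A \<subseteq> S \<Longrightarrow> c A \<in> superstructure c S"
  by (rule code_in_superstructure[of _ _ _ 0]) simp

lemma nsext_standard_iff:
  assumes "A \<subseteq> S" and "a \<in> S"
  shows "a \<in> nsext c S' star A \<longleftrightarrow> a \<in> A"
proof -
  have "star a \<in> elts c S' (star (c A)) \<longleftrightarrow> a \<in> elts c S (c A)"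
    using assms
    by (intro transfer_Mem[OF M] code_subset_in_superstructure individual_in_superstructure)
  then show ?thesis
    using assms by (simp add: nsext_def elts_standard star_individual)
qed

text \<open>
  Both inclusions are transferred, since \<open>A - B\<close> is determined among the subsets of \<open>S\<close> by the
  bounded formulas \<open>\<forall>z\<in>A - B. z \<in> A \<and> z \<notin> B\<close> and \<open>\<forall>z\<in>A. \<not> (z \<notin> B \<and> z \<notin> A - B)\<close>.
\<close>

lemma nsext_Diff:
  assumes "A \<subseteq> S" and "B \<subseteq> S"
  shows "nsext c S' star (A - B) = nsext c S' star A - nsext c S' star B"
proof -
  define \<rho> :: "nat \<Rightarrow> 'u" where "\<rho> = (\<lambda>_. c (A - B))(1 := c A, 2 := c B)"
  have \<rho>: "range \<rho> \<subseteq> superstructure c S"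
    using assms code_subset_in_superstructure[of A] code_subset_in_superstructure[of B]
      code_subset_in_superstructure[of "A - B"] by (auto simp: \<rho>_def)
  have E: "elts c S (c (A - B)) = A - B" "elts c S (c A) = A" "elts c S (c B) = B"
    using assms by (auto intro!: elts_standard)
  have "holds (elts c S) \<rho> (BAll 3 0 (And (Mem 3 1) (Not (Mem 3 2))))"
    by (simp add: \<rho>_def E)
  then have "holds (elts c S') (star \<circ> \<rho>) (BAll 3 0 (And (Mem 3 1) (Not (Mem 3 2))))"
    using transfer[OF M \<rho>] by blast
  then have 1: "nsext c S' star (A - B) \<subseteq> nsext c S' star A - nsext c S' star B"
    by (auto simp: \<rho>_def nsext_def)
  have "holds (elts c S) \<rho> (BAll 3 1 (Not (And (Not (Mem 3 2)) (Not (Mem 3 0)))))"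
    by (simp add: \<rho>_def E)
  then have "holds (elts c S') (star \<circ> \<rho>) (BAll 3 1 (Not (And (Not (Mem 3 2)) (Not (Mem 3 0)))))"
    using transfer[OF M \<rho>] by blast
  then have 2: "nsext c S' star A - nsext c S' star B \<subseteq> nsext c S' star (A - B)"
    by (auto simp: \<rho>_def nsext_def)
  from 1 2 show ?thesis by blast
qed

lemma nsext_empty: "nsext c S' star {} = {}"
  using nsext_Diff[of "{}" "{}"] by simp

lemma nsext_Int:
  assumes "A \<subseteq> S" and "B \<subseteq> S"
  shows "nsext c S' star (A \<inter> B) = nsext c S' star A \<inter> nsext c S' star B"
proof -
  have "A \<inter> B = A - (A - B)" by blast
  moreover have "A - B \<subseteq> S" using assms by blast
  ultimately show ?thesis
    using assms by (simp only: nsext_Diff) blast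
qed

lemma nsext_singleton:
  assumes "x \<in> S"
  shows "nsext c S' star {x} = {x}"
proof -
  define \<rho> :: "nat \<Rightarrow> 'u" where "\<rho> = (\<lambda>_. c {x})(1 := x)"
  have "range \<rho> \<subseteq> superstructure c S"
    using assms code_subset_in_superstructure[of "{x}"] individual_in_superstructure[of x S c]
    by (auto simp: \<rho>_def)
  moreover have "holds (elts c S) \<rho> (BAll 2 0 (Eq 2 1))"
    using assms by (simp add: \<rho>_def elts_standard)
  ultimately have "holds (elts c S') (star \<circ> \<rho>) (BAll 2 0 (Eq 2 1))"
    using transfer[OF M] by blast
  then have "nsext c S' star {x} \<subseteq> {x}"
    using assms by (auto simp: \<rho>_def nsext_def star_individual)
  moreover have "x \<in> nsext c S' star {x}"
    using assms by (simp add: nsext_standard_iff)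
  ultimately show ?thesis by blast
qed

section \<open>Saturation\<close>

text \<open>
  \<open>\<^sup>*A\<close> is an element of \<open>\<^sup>*{A}\<close>. It is a set and not an individual because \<open>A \<notin> S\<close>
  transfers to \<open>\<^sup>*A \<notin> \<^sup>*S\<close>.
\<close>

lemma internal_star_code:
  assumes "A \<subseteq> S"
  shows "internal c S S' star (star (c A))"
proof -
  have cA: "c A \<in> superstructure c S"
    using assms by (rule code_subset_in_superstructure)
  have "star (c A) \<in> superstructure c S'"
    using M cA unfolding polysaturated_model_def by (elim conjE) (rule subsetD[OF _ imageI])
  moreover have "star (c A) \<notin> S'"
  proof -
    have "c A \<notin> elts c S (c S)"
      using code_not_individual[OF codes_standard, of A 0] assms elts_standard[of S] by simp
    then have "star (c A) \<notin> elts c S' (star (c S))"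
      using transfer_Mem[OF M cA] code_subset_in_superstructure[of S] by simp
    moreover have "star (c S) = c S'"
      using M unfolding polysaturated_model_def by (elim conjE)
    moreover have "elts c S' (c S') = S'"
      by (rule elts_code[OF codes_nonstandard, of _ 0]) simp
    ultimately show ?thesis by simp
  qed
  moreover have "star (c A) \<in> elts c S' (star (c {c A}))"
    and "c {c A} \<in> superstructure c S"
  proof -
    have lev: "{c A} \<subseteq> level c S 1" using assms by auto
    show 1: "c {c A} \<in> superstructure c S"
      using lev by (rule code_in_superstructure)
    show "star (c A) \<in> elts c S' (star (c {c A}))"
      using transfer_Mem[OF M cA 1] elts_code[OF codes_standard lev] by simp
  qed
  ultimately show ?thesis
    unfolding internal_def by blast
qed

text \<open>
  For families of standard extensions the finite intersection property can be tested on the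
  standard sets, since a standard witness is its own star. The cardinality bound is automatic: each
  member of the family is the star of an object of the standard superstructure.
\<close>

lemma nsext_saturation:
  assumes sub: "\<And>A. A \<in> \<A> \<Longrightarrow> A \<subseteq> S"
    and fip: "\<And>\<G>. finite \<G> \<Longrightarrow> \<G> \<subseteq> \<A> \<Longrightarrow> \<G> \<noteq> {} \<Longrightarrow> \<Inter>\<G> \<noteq> {}"
  shows "(\<Inter>A\<in>\<A>. nsext c S' star A) \<noteq> {}"
proof -
  define F where "F = star ` c ` \<A>"
  have sat: "\<Inter> (elts c S' ` F) \<noteq> {}"
    if "\<forall>B\<in>F. internal c S S' star B" "|F| \<le>o \<kappa>"
      "\<forall>G. finite G \<and> G \<subseteq> F \<longrightarrow> \<Inter> (elts c S' ` G) \<noteq> {}"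
  proof -
    have "\<forall>F. (\<forall>B\<in>F. internal c S S' star B) \<and> |F| \<le>o \<kappa> \<and>
        (\<forall>G. finite G \<and> G \<subseteq> F \<longrightarrow> \<Inter> (elts c S' ` G) \<noteq> {}) \<longrightarrow> \<Inter> (elts c S' ` F) \<noteq> {}"
      using M unfolding polysaturated_model_def by (elim conjE)
    from this[THEN spec, of F] show ?thesis
      by (rule mp) (intro conjI that)
  qed
  have "\<Inter> (elts c S' ` F) \<noteq> {}"
  proof (rule sat)
    show "\<forall>B\<in>F. internal c S S' star B"
      using sub internal_star_code by (auto simp: F_def)
    have "c ` \<A> \<subseteq> superstructure c S"
      using sub by (auto intro: code_subset_in_superstructure)
    then have "|F| \<le>o |superstructure c S|"
      unfolding F_def by (intro ordLeq_transitive[OF card_of_image card_of_mono1])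
    moreover have "|superstructure c S| \<le>o \<kappa>"
      using M unfolding polysaturated_model_def by (elim conjE)
    ultimately show "|F| \<le>o \<kappa>" by (rule ordLeq_transitive)
    show "\<forall>G. finite G \<and> G \<subseteq> F \<longrightarrow> \<Inter> (elts c S' ` G) \<noteq> {}"
    proof (intro allI impI)
      fix G assume "finite G \<and> G \<subseteq> F"
      then obtain \<G> where \<G>: "finite \<G>" "\<G> \<subseteq> \<A>" "G = (\<lambda>A. star (c A)) ` \<G>"
        using finite_subset_image[of G "\<lambda>A. star (c A)" \<A>] by (auto simp: F_def image_image)
      show "\<Inter> (elts c S' ` G) \<noteq> {}"
      proof (cases "\<G> = {}")
        case True
        then show ?thesis using \<G> by simp
      next
        case False
        then obtain y where y: "y \<in> \<Inter>\<G>" using fip \<G> by blast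
        then have "y \<in> S" using False \<G> sub by blast
        then have "y \<in> nsext c S' star A" if "A \<in> \<G>" for A
          using nsext_standard_iff[of A y] sub \<G> y that by blast
        then show ?thesis
          using \<G> by (auto simp: nsext_def)
      qed
    qed
  qed
  then show ?thesis by (simp add: F_def nsext_def image_image)
qed

section \<open>Halos and limit points\<close>

theorem halo_meets_iff_limit_point:
  assumes T: "topspace T \<subseteq> S" and A: "A \<subseteq> topspace T" and x: "x \<in> topspace T"
  shows "halo c S' star T x \<inter> (nsext c S' star A - {x}) \<noteq> {} \<longleftrightarrow> x \<in> T derived_set_of A"
proof -
  define N where "N = {U. openin T U \<and> x \<in> U}"
  define W where "W U = U \<inter> A - {x}" for U
  have top: "topspace T \<in> N" using x by (simp add: N_def)
  have US: "U \<subseteq> S" if "U \<in> N" for U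
    using that T openin_subset by (fastforce simp: N_def)
  have WS: "W U \<subseteq> S" if "U \<in> N" for U
    using US[OF that] by (auto simp: W_def)
  have W: "nsext c S' star (W U) = nsext c S' star U \<inter> nsext c S' star A - {x}" if "U \<in> N" for U
  proof -
    have "nsext c S' star (W U) = nsext c S' star (U \<inter> A) - nsext c S' star {x}"
      unfolding W_def using US[OF that] x T by (intro nsext_Diff) auto
    also have "\<dots> = nsext c S' star U \<inter> nsext c S' star A - {x}"
      using US[OF that] A T x by (subst nsext_Int) (auto simp: nsext_singleton)
    finally show ?thesis .
  qed
  have halo: "halo c S' star T x \<inter> (nsext c S' star A - {x}) = (\<Inter>U\<in>N. nsext c S' star (W U))"
    using top W by (auto simp: halo_def N_def)
  have limit: "x \<in> T derived_set_of A \<longleftrightarrow> (\<forall>U\<in>N. W U \<noteq> {})"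
    using x by (auto simp: in_derived_set_of N_def W_def)
  show ?thesis
  proof
    assume "halo c S' star T x \<inter> (nsext c S' star A - {x}) \<noteq> {}"
    then have "\<forall>U\<in>N. W U \<noteq> {}"
      unfolding halo using nsext_empty by fastforce
    then show "x \<in> T derived_set_of A" by (simp add: limit)
  next
    assume "x \<in> T derived_set_of A"
    then have ne: "\<forall>U\<in>N. W U \<noteq> {}" by (simp add: limit)
    have "(\<Inter>B\<in>W ` N. nsext c S' star B) \<noteq> {}"
    proof (rule nsext_saturation)
      show "B \<subseteq> S" if "B \<in> W ` N" for B using that WS by blast
      fix \<G> assume "finite \<G>" "\<G> \<subseteq> W ` N" "\<G> \<noteq> {}"
      then obtain \<U> where \<U>: "finite \<U>" "\<U> \<subseteq> N" "\<U> \<noteq> {}" "\<G> = W ` \<U>"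
        using finite_subset_image[of \<G> W N] by auto
      have "\<Inter>\<U> \<in> N"
        using \<U> by (auto simp: N_def intro!: openin_Inter)
      then obtain y where "y \<in> W (\<Inter>\<U>)" using ne by blast
      then have "y \<in> \<Inter>\<G>" using \<U> by (auto simp: W_def)
      then show "\<Inter>\<G> \<noteq> {}" by blast
    qed
    then show "halo c S' star T x \<inter> (nsext c S' star A - {x}) \<noteq> {}"
      unfolding halo by (simp add: image_image)
  qed
qed

end

lemma extension_subset_topspace:
  assumes "\<And>p. \<nu> p \<subseteq> topspace T"
  shows "extension c S' star T \<nu> \<phi> \<subseteq> topspace T"
  using assms by (induction \<phi>) auto

theorem proposition5p3:
  fixes T :: "'u topology"
    and \<iota> :: "real \<Rightarrow> 'u"
    and c :: "'u set \<Rightarrow> 'u"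
    and S S' :: "'u set"
    and star :: "'u \<Rightarrow> 'u"
    and \<kappa> :: "'k rel"
    and \<nu> :: "'p \<Rightarrow> 'u set"
    and \<phi> :: "'p fm"
  assumes "inj \<iota>"
    and "S = topspace T \<union> range \<iota>"
    and "polysaturated_model c S S' star \<kappa>"
    and "\<And>p. \<nu> p \<subseteq> topspace T"
  shows "extension c S' star T \<nu> (Diamond_d \<phi>) = T derived_set_of (extension c S' star T \<nu> \<phi>)"
proof -
  let ?A = "extension c S' star T \<nu> \<phi>"
  have "halo c S' star T x \<inter> (nsext c S' star ?A - {x}) \<noteq> {} \<longleftrightarrow> x \<in> T derived_set_of ?A"
    if "x \<in> topspace T" for x
    using assms(2) that
    by (intro halo_meets_iff_limit_point[OF assms(3)] extension_subset_topspace assms(4)) auto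
  then show ?thesis
    using derived_set_of_subset_topspace[of T ?A] by auto
qed

end
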